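(* Every ASR-graph $G$ with $|V(G)|\geq 3$ is $\gamma$-insensitive.
   Context: $\gamma(G)$ denotes the domination number of a finite simple graph $G$. For an edge $e=uv$ of $G$, $G-e$ is the graph obtained by deleting $e$, and $G_e$ is the graph obtained by subdividing $e$: delete $e$, add a new vertex $w$ and the edges $uw$ and $wv$. A finite connected simple graph $G$ of order at least two is an ASR-graph (anti-sub-removable graph) if $\gamma(G-e)\neq\gamma(G_e)$ for every edge $e$ of $G$. A graph $G$ is $\gamma$-insensitive if $\gamma(G-e)=\gamma(G)$ for every edge $e$ of $G$. *)

theory Defs
  imports "Graph_Theory.Digraph_Component" "Graph_Theory.Pair_Digraph"
begin

text \<open>
  Finite simple graphs are rendered by the locale \<^locale>\<open>pair_graph\<close>: finite, loop-free digraphs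
  whose arc relation is symmetric, so that an edge \<open>uv\<close> is the pair of arcs \<open>(u, v)\<close> and \<open>(v, u)\<close>.
\<close>

definition dominating_set :: "'a pair_pre_digraph \<Rightarrow> 'a set \<Rightarrow> bool" where
  "dominating_set G D \<longleftrightarrow>
     D \<subseteq> pverts G \<and> (\<forall>v \<in> pverts G - D. \<exists>u \<in> D. (u, v) \<in> parcs G)"

definition domination_number :: "'a pair_pre_digraph \<Rightarrow> nat" where
  "domination_number G = Min (card ` {D. dominating_set G D})"

definition delete_edge :: "'a pair_pre_digraph \<Rightarrow> 'a \<times> 'a \<Rightarrow> 'a pair_pre_digraph" where
  "delete_edge G e = \<lparr> pverts = pverts G, parcs = parcs G - {e, prod.swap e} \<rparr>"

text \<open>
  The library's \<^const>\<open>subdivide\<close> takes the new vertex as an argument. The vertices of \<open>G\<close> may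
  exhaust the type \<open>'a\<close>, so \<open>G\<close> is first copied to the type \<open>'a option\<close>, where \<^const>\<open>None\<close> is
  always a fresh vertex.
\<close>

definition option_copy :: "'a pair_pre_digraph \<Rightarrow> 'a option pair_pre_digraph" where
  "option_copy G = \<lparr> pverts = Some ` pverts G, parcs = map_prod Some Some ` parcs G \<rparr>"

definition subdivide_edge :: "'a pair_pre_digraph \<Rightarrow> 'a \<times> 'a \<Rightarrow> 'a option pair_pre_digraph" where
  "subdivide_edge G e = subdivide (option_copy G) (map_prod Some Some e) None"

definition ASR_graph :: "'a pair_pre_digraph \<Rightarrow> bool" where
  "ASR_graph G \<longleftrightarrow>
     pair_graph G \<and> connected (with_proj G) \<and> card (pverts G) \<ge> 2 \<and>
     (\<forall>e \<in> parcs G.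
        domination_number (delete_edge G e) \<noteq> domination_number (subdivide_edge G e))"

definition gamma_insensitive :: "'a pair_pre_digraph \<Rightarrow> bool" where
  "gamma_insensitive G \<longleftrightarrow>
     (\<forall>e \<in> parcs G. domination_number (delete_edge G e) = domination_number G)"

lemma pair_graph_delete_edge:
  assumes "pair_graph G"
  shows "pair_graph (delete_edge G e)"
proof -
  interpret pair_graph G by fact
  have "symmetric (with_proj (delete_edge G e))"
    unfolding symmetric_def
    by (rule symI) (cases e, auto simp: delete_edge_def dest: arcs_symmetric)
  then show ?thesis
    by unfold_locales
      (auto simp: delete_edge_def dest: in_arcsD1 in_arcsD2 pair_no_loops)
qed

lemma pair_graph_option_copy:
  assumes "pair_graph G"
  shows "pair_graph (option_copy G)"
proof -
  interpret pair_graph G by fact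
  have "symmetric (with_proj (option_copy G))"
    unfolding symmetric_def
    by (rule symI) (force simp: option_copy_def dest: arcs_symmetric)
  then show ?thesis
    by unfold_locales
      (auto simp: option_copy_def dest: in_arcsD1 in_arcsD2 pair_no_loops)
qed

lemma pair_graph_subdivide_edge:
  assumes "pair_graph G" "e \<in> parcs G"
  shows "pair_graph (subdivide_edge G e)"
  unfolding subdivide_edge_def
  by (rule pair_graph.pair_graph_subdivide[OF pair_graph_option_copy[OF assms(1)]])
    (use assms(2) in \<open>auto simp: option_copy_def\<close>)

end

theory Submission
  imports Defs
begin

text \<open>
  Deleting or subdividing an edge changes the domination number by \<open>0\<close> or \<open>1\<close>. If
  \<open>\<gamma>(G - uv) \<noteq> \<gamma>(G)\<close>, then the ASR property forces \<open>\<gamma>(G\<^sub>u\<^sub>v) = \<gamma>(G)\<close>, and a minimum dominating set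
  of \<open>G\<^sub>u\<^sub>v\<close> must contain the subdividing vertex. Removing that vertex leaves a set \<open>D\<close> of size
  \<open>\<gamma>(G) - 1\<close> that dominates all vertices except \<open>u\<close> and \<open>v\<close>, neither of which it contains or
  dominates. By connectedness some \<open>x \<notin> {u, v}\<close> is adjacent to \<open>u\<close>, say. Then \<open>D \<union> {u}\<close> is a
  minimum dominating set of both \<open>G - ux\<close> and \<open>G\<^sub>u\<^sub>x\<close>, contradicting the ASR property at \<open>ux\<close>.
\<close>

section \<open>Domination in \<open>G\<close> with an edge deleted or subdivided\<close>

lemma delete_edge_simps [simp]:
  "pverts (delete_edge G e) = pverts G"
  "parcs (delete_edge G (u, v)) = parcs G - {(u, v), (v, u)}"
  by (auto simp: delete_edge_def)

lemma subdivide_edge_simps [simp]: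
  "pverts (subdivide_edge G e) = insert None (Some ` pverts G)"
  "(Some a, Some b) \<in> parcs (subdivide_edge G (u, v)) \<longleftrightarrow> (a, b) \<in> parcs (delete_edge G (u, v))"
  "(None, Some b) \<in> parcs (subdivide_edge G (u, v)) \<longleftrightarrow> b \<in> {u, v}"
  "(Some a, None) \<in> parcs (subdivide_edge G (u, v)) \<longleftrightarrow> a \<in> {u, v}"
  by (auto simp: subdivide_edge_def option_copy_def)

text \<open>The neighbours of \<open>None\<close> are just \<open>u\<close> and \<open>v\<close>, so
  one of them has to be chosen; between old vertices the arcs are those of the edge-deleted
  graph.\<close>

lemma dominating_set_subdivide_edge_without_new:
  "dominating_set (subdivide_edge G (u, v)) (Some ` D) \<longleftrightarrow>
     dominating_set (delete_edge G (u, v)) D \<and> (u \<in> D \<or> v \<in> D)"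
  unfolding dominating_set_def
  by (auto simp: Ball_def Bex_def image_iff split_option_all split_option_ex
      simp del: delete_edge_simps(2))

text \<open>\<open>None\<close> takes care of itself, \<open>u\<close> and \<open>v\<close>, and of
  nothing else.\<close>

lemma dominating_set_subdivide_edge_with_new:
  "dominating_set (subdivide_edge G (u, v)) (insert None (Some ` D)) \<longleftrightarrow>
     D \<subseteq> pverts G \<and>
     (\<forall>x \<in> pverts G - D - {u, v}. \<exists>y \<in> D. (y, x) \<in> parcs (delete_edge G (u, v)))"
  unfolding dominating_set_def
  by (auto simp: Ball_def Bex_def image_iff split_option_all split_option_ex
      simp del: delete_edge_simps(2))

lemma dominating_set_delete_edgeD:
  assumes "dominating_set (delete_edge G e) D"
  shows "dominating_set G D"
  using assms unfolding dominating_set_def delete_edge_def by auto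

section \<open>Minimum dominating sets\<close>

lemma finite_dominating_sets:
  assumes "finite (pverts G)"
  shows "finite {D. dominating_set G D}"
  by (rule finite_subset[of _ "Pow (pverts G)"]) (use assms in \<open>auto simp: dominating_set_def\<close>)

lemma domination_number_le:
  assumes "finite (pverts G)" "dominating_set G D"
  shows "domination_number G \<le> card D"
  unfolding domination_number_def using finite_dominating_sets[OF assms(1)] assms(2) by auto

lemma minimum_dominating_set:
  assumes "finite (pverts G)"
  obtains D where "dominating_set G D" "card D = domination_number G"
proof -
  have "dominating_set G (pverts G)"
    by (simp add: dominating_set_def)
  then have "domination_number G \<in> card ` {D. dominating_set G D}"
    unfolding domination_number_def using finite_dominating_sets[OF assms] by (intro Min_in) auto
  with that show thesis by auto
qed

lemma domination_number_le_delete_edge: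
  assumes "finite (pverts G)"
  shows "domination_number G \<le> domination_number (delete_edge G e)"
proof -
  obtain D where D: "dominating_set (delete_edge G e) D"
      "card D = domination_number (delete_edge G e)"
    using minimum_dominating_set[of "delete_edge G e"] assms by auto
  show ?thesis
    using domination_number_le[OF assms dominating_set_delete_edgeD[OF D(1)]] D(2) by simp
qed

lemma dominating_set_subdivide_edge_cases:
  assumes "finite (pverts G)" "dominating_set (subdivide_edge G (u, v)) S"
  obtains (without_new) D where "S = Some ` D" "card S = card D"
      "dominating_set (delete_edge G (u, v)) D"
    | (with_new) D where "finite D" "card S = Suc (card D)" "D \<subseteq> pverts G"
      "\<And>x. x \<in> pverts G \<Longrightarrow> x \<notin> D \<Longrightarrow> x \<notin> {u, v} \<Longrightarrow>
        \<exists>y \<in> D. (y, x) \<in> parcs (delete_edge G (u, v))"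
proof -
  define D where "D = Some -` S"
  have card: "card (Some ` D) = card D"
    by (simp add: card_image)
  show thesis
  proof (cases "None \<in> S")
    case True
    have "x \<in> insert None (Some ` D) \<longleftrightarrow> x \<in> S" for x
      using True by (cases x) (auto simp: D_def)
    then have S: "S = insert None (Some ` D)"
      by blast
    note dom = assms(2)[unfolded S dominating_set_subdivide_edge_with_new]
    have "finite D"
      using dom assms(1) finite_subset by blast
    then show thesis
      using dom card by (intro with_new[of D]) (auto simp: S)
  next
    case False
    have "x \<in> Some ` D \<longleftrightarrow> x \<in> S" for x
      using False by (cases x) (auto simp: D_def)
    then have S: "S = Some ` D"
      by blast
    with assms(2) show thesis
      using card by (intro without_new[of D]) (auto simp: dominating_set_subdivide_edge_without_new)
  qed
qed

text \<open>Otherwise \<open>A\<close> would be closed under arcs and so contain every vertex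
  reachable from it; by symmetry of the arcs, that is every vertex.\<close>

lemma (in pair_sym_digraph) connected_edge_leaving:
  assumes "connected (with_proj G)" "A \<subseteq> pverts G" "A \<noteq> {}" "A \<noteq> pverts G"
  obtains a x where "a \<in> A" "x \<notin> A" "(a, x) \<in> parcs G"
proof -
  have sc: "strongly_connected (with_proj G)"
    using symmetric_connected_imp_strongly_connected[OF pair_sym_arcs assms(1)] .
  obtain a x where ax: "a \<in> A" "x \<in> pverts G" "x \<notin> A"
    using assms(2-4) by blast
  then have "a \<rightarrow>\<^sup>*\<^bsub>with_proj G\<^esub> x"
    using sc assms(2) by (auto simp: strongly_connected_def)
  then have "(a, x) \<in> (parcs G)\<^sup>*"
    using reachable_rtranclI by fastforce
  moreover have False if "\<And>a x. a \<in> A \<Longrightarrow> (a, x) \<in> parcs G \<Longrightarrow> x \<in> A"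
    using Image_closed_trancl[of "parcs G" A] calculation ax that by blast
  ultimately show thesis
    using that by blast
qed

section \<open>How far deletion and subdivision move the domination number\<close>

context pair_graph
begin

text \<open>The new vertex, if chosen, can be exchanged for \<open>u\<close>, which dominates
  \<open>v\<close> in \<open>G\<close>.\<close>

lemma domination_number_le_subdivide_edge:
  assumes "(u, v) \<in> parcs G"
  shows "domination_number G \<le> domination_number (subdivide_edge G (u, v))"
proof -
  obtain S where S: "dominating_set (subdivide_edge G (u, v)) S"
      "card S = domination_number (subdivide_edge G (u, v))"
    using minimum_dominating_set[of "subdivide_edge G (u, v)"] pair_finite_verts by auto
  from pair_finite_verts S(1) show ?thesis
  proof (cases rule: dominating_set_subdivide_edge_cases)
    case (without_new D)
    then show ?thesis
      using domination_number_le[OF pair_finite_verts dominating_set_delete_edgeD] S(2) by metis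
  next
    case (with_new D)
    have "dominating_set G (insert u D)"
      using with_new(3,4) assms in_arcsD1[OF assms]
      unfolding dominating_set_def delete_edge_simps(2) by blast
    from domination_number_le[OF pair_finite_verts this] show ?thesis
      using with_new(1,2) S(2) by (auto simp: card_insert_if split: if_splits)
  qed
qed

text \<open>Only \<open>u\<close> and \<open>v\<close> can lose their dominators; adding the new
  vertex covers both.\<close>

lemma domination_number_subdivide_edge_le:
  assumes "(u, v) \<in> parcs G"
  shows "domination_number (subdivide_edge G (u, v)) \<le> Suc (domination_number G)"
proof -
  obtain D where D: "dominating_set G D" "card D = domination_number G"
    using minimum_dominating_set[OF pair_finite_verts] .
  have "dominating_set (subdivide_edge G (u, v)) (insert None (Some ` D))"
    unfolding dominating_set_subdivide_edge_with_new
    using D(1) unfolding dominating_set_def delete_edge_simps by blast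
  from domination_number_le[OF _ this]
  have "domination_number (subdivide_edge G (u, v)) \<le> card (insert None (Some ` D))"
    using pair_finite_verts by simp
  also have "\<dots> \<le> Suc (card (Some ` D))"
    by (rule card_insert_le_m1) simp_all
  finally show ?thesis
    using D(2) by (simp add: card_image)
qed

text \<open>At most one endpoint loses its last dominator: only \<open>v\<close> can if
  \<open>u\<close> is chosen, and only \<open>u\<close> otherwise. Adding that endpoint repairs the
  set.\<close>

lemma domination_number_delete_edge_le:
  assumes "(u, v) \<in> parcs G"
  shows "domination_number (delete_edge G (u, v)) \<le> Suc (domination_number G)"
proof -
  obtain D where D: "dominating_set G D" "card D = domination_number G"
    using minimum_dominating_set[OF pair_finite_verts] .
  obtain z where "dominating_set (delete_edge G (u, v)) (insert z D)"
  proof (cases "u \<in> D")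
    case True
    then have "dominating_set (delete_edge G (u, v)) (insert v D)"
      using D(1) in_arcsD2[OF assms] unfolding dominating_set_def delete_edge_simps by blast
    then show thesis by (rule that)
  next
    case False
    then have "dominating_set (delete_edge G (u, v)) (insert u D)"
      using D(1) in_arcsD1[OF assms] unfolding dominating_set_def delete_edge_simps by blast
    then show thesis by (rule that)
  qed
  from domination_number_le[OF _ this]
  have "domination_number (delete_edge G (u, v)) \<le> card (insert z D)"
    using pair_finite_verts by simp
  also have "\<dots> \<le> Suc (card D)"
    by (rule card_insert_le_m1) simp_all
  finally show ?thesis
    using D(2) by simp
qed

text \<open>A minimum dominating set of the subdivision must use the new vertex, as it would
  otherwise dominate the edge-deleted graph with too few vertices. \<open>D\<close> is what remains
  without it.\<close>

lemma dominates_all_but_critical_edge: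
  assumes e: "(u, v) \<in> parcs G"
    and del: "domination_number (delete_edge G (u, v)) > domination_number G"
    and sub: "domination_number (subdivide_edge G (u, v)) \<le> domination_number G"
  obtains D where "D \<subseteq> pverts G" "Suc (card D) = domination_number G"
    "\<And>a y. a \<in> {u, v} \<Longrightarrow> y \<in> D \<Longrightarrow> y \<noteq> a \<and> (y, a) \<notin> parcs G"
    "\<And>x. x \<in> pverts G \<Longrightarrow> x \<notin> D \<Longrightarrow> x \<notin> {u, v} \<Longrightarrow> \<exists>y \<in> D. (y, x) \<in> parcs G"
proof -
  obtain S where S: "dominating_set (subdivide_edge G (u, v)) S"
      "card S = domination_number (subdivide_edge G (u, v))"
    using minimum_dominating_set[of "subdivide_edge G (u, v)"] pair_finite_verts by auto
  have small: "\<not> dominating_set (delete_edge G (u, v)) D" if "card D \<le> domination_number G" for D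
    using domination_number_le[of "delete_edge G (u, v)" D] pair_finite_verts del that by auto
  from pair_finite_verts S(1) show thesis
  proof (cases rule: dominating_set_subdivide_edge_cases)
    case (without_new D)
    then show thesis
      using small S(2) sub by auto
  next
    case (with_new D)
    have card: "Suc (card D) = domination_number G"
      using domination_number_le_subdivide_edge[OF e] S(2) sub with_new(2) by simp
    \<comment> \<open>Adding one vertex to \<open>D\<close> still gives at most \<gamma>(G)
      vertices.\<close>
    have nd: "\<not> dominating_set (delete_edge G (u, v)) (insert z D)" for z
      by (rule small) (use with_new(1) card in \<open>auto simp: card_insert_if\<close>)
    \<comment> \<open>If \<open>D\<close> contained or dominated \<open>a\<close>, only
      \<open>b\<close> could be undominated, and adding \<open>b\<close> would contradict
      \<open>nd\<close>.\<close>
    have isolated: "a \<notin> D \<and> (\<forall>y \<in> D. (y, a) \<notin> parcs (delete_edge G (u, v)))"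
      if ab: "{u, v} = {a, b}" for a b
    proof (rule ccontr)
      assume "\<not> ?thesis"
      moreover have "b \<in> pverts G"
        using ab in_arcsD1[OF e] in_arcsD2[OF e] by (auto simp: doubleton_eq_iff)
      ultimately have "dominating_set (delete_edge G (u, v)) (insert b D)"
        using with_new(3) with_new(4)[unfolded ab]
        unfolding dominating_set_def delete_edge_simps(1) by blast
      with nd show False by blast
    qed
    \<comment> \<open>Neither endpoint lies in \<open>D\<close>, so the deleted arcs do not start in
      \<open>D\<close> and non-domination carries over to \<open>G\<close>.\<close>
    note iso = isolated[of u v] isolated[of v u]
    show thesis
    proof (rule that)
      show "y \<noteq> a \<and> (y, a) \<notin> parcs G" if "a \<in> {u, v}" "y \<in> D" for a y
        using that iso by auto
      show "\<exists>y \<in> D. (y, x) \<in> parcs G" if "x \<in> pverts G" "x \<notin> D" "x \<notin> {u, v}" for x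
        using with_new(4)[OF that] by auto
    qed (use with_new(3) card in auto)
  qed
qed

end

theorem corollary17:
  fixes G :: "'a pair_pre_digraph"
  assumes "ASR_graph G" and "card (pverts G) \<ge> 3"
  shows "gamma_insensitive G"
proof -
  have graph: "pair_graph G" and conn: "connected (with_proj G)"
    and asr: "\<And>e. e \<in> parcs G \<Longrightarrow>
      domination_number (delete_edge G e) \<noteq> domination_number (subdivide_edge G e)"
    using assms(1) by (auto simp: ASR_graph_def)
  interpret pair_graph G by (rule graph)
  show ?thesis
    unfolding gamma_insensitive_def
  proof (rule ballI, rule ccontr)
    fix e
    assume "e \<in> parcs G" and ne: "domination_number (delete_edge G e) \<noteq> domination_number G"
    obtain u v where e: "e = (u, v)" by (cases e)
    have uv: "(u, v) \<in> parcs G"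
      using \<open>e \<in> parcs G\<close> e by simp
    have del: "domination_number (delete_edge G (u, v)) > domination_number G"
      using ne domination_number_le_delete_edge[OF pair_finite_verts, of e] e by simp
    \<comment> \<open>Deletion gives exactly \<gamma>(G) + 1, the largest value possible for
      subdivision, and the ASR property rules that value out.\<close>
    have "domination_number (subdivide_edge G (u, v)) \<le> domination_number G"
      using del domination_number_delete_edge_le[OF uv]
        domination_number_subdivide_edge_le[OF uv] asr[OF uv] by simp
    from dominates_all_but_critical_edge[OF uv del this]
    obtain D where D: "D \<subseteq> pverts G" "Suc (card D) = domination_number G"
      and isolated: "\<And>a y. a \<in> {u, v} \<Longrightarrow> y \<in> D \<Longrightarrow> y \<noteq> a \<and> (y, a) \<notin> parcs G"
      and dom: "\<And>x. x \<in> pverts G \<Longrightarrow> x \<notin> D \<Longrightarrow> x \<notin> {u, v} \<Longrightarrow> \<exists>y \<in> D. (y, x) \<in> parcs G"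
      by metis
    have uv_verts: "{u, v} \<subseteq> pverts G"
      using uv in_arcsD1 in_arcsD2 by blast
    have "card {u, v} \<le> 2"
      by (simp add: card_insert_if)
    then have "{u, v} \<noteq> pverts G"
      using assms(2) by auto
    then obtain a x where ax: "a \<in> {u, v}" "x \<notin> {u, v}" "(a, x) \<in> parcs G"
      using connected_edge_leaving[OF conn uv_verts] by blast
    have xa: "(x, a) \<in> parcs G"
      using ax(3) by (rule arcs_symmetric)
    have "x \<notin> D"
      using isolated[OF ax(1)] xa by blast
    \<comment> \<open>\<open>a\<close> reaches the other endpoint through \<open>uv\<close>, which
      differs from \<open>ax\<close>. All other vertices, \<open>x\<close> included, are dominated
      from \<open>D\<close>, which avoids both ends of \<open>ax\<close>.\<close>
    have dominating: "dominating_set (delete_edge G (a, x)) (insert a D)"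
      unfolding dominating_set_def
    proof (intro conjI ballI)
      show "insert a D \<subseteq> pverts (delete_edge G (a, x))"
        using D(1) uv_verts ax(1) by auto
      fix z assume z: "z \<in> pverts (delete_edge G (a, x)) - insert a D"
      show "\<exists>y \<in> insert a D. (y, z) \<in> parcs (delete_edge G (a, x))"
      proof (cases "z \<in> {u, v}")
        case True
        then have "(a, z) \<in> parcs G"
          using z ax(1) uv arcs_symmetric[OF uv] by auto
        then show ?thesis
          using True z ax(1,2) by auto
      next
        case False
        then obtain y where "y \<in> D" "(y, z) \<in> parcs G"
          using dom z by auto
        then show ?thesis
          using isolated[OF ax(1)] \<open>x \<notin> D\<close> by auto
      qed
    qed
    \<comment> \<open>The chosen endpoint \<open>a\<close> dominates the subdividing vertex.\<close>
    then have dominating': "dominating_set (subdivide_edge G (a, x)) (Some ` insert a D)"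
      unfolding dominating_set_subdivide_edge_without_new by simp
    have "a \<notin> D"
      using isolated[OF ax(1)] by blast
    then have card: "card (insert a D) = domination_number G"
      using D finite_subset[OF D(1) pair_finite_verts] by simp
    \<comment> \<open>Neither operation lowers the domination number, so a dominating set of size
      \<gamma>(G) fixes both values at \<gamma>(G).\<close>
    have "domination_number (delete_edge G (a, x)) = domination_number G"
      using domination_number_le[OF _ dominating] pair_finite_verts card
        domination_number_le_delete_edge[OF pair_finite_verts, of "(a, x)"] by simp
    moreover have "domination_number (subdivide_edge G (a, x)) = domination_number G"
      using domination_number_le[OF _ dominating'] pair_finite_verts
        card card_image[OF inj_on_subset[OF inj_Some subset_UNIV], of "insert a D"]
        domination_number_le_subdivide_edge[OF ax(3)]
      by (simp del: image_insert)
    ultimately show False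
      using asr[OF ax(3)] by simp
  qed
qed

end
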